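(* Let $f$ be the ensemble text classifier with $m$ groups (defined in the context), let $\mathcal{D}(\emptyset)$ be the certified training dataset (without a backdoor trigger), and let $f^1,\dots,f^m$ be the base classifiers trained on the $m$ sub-datasets created from $\mathcal{D}(\emptyset)$. Let $\mathbf{x}_{test}$ be a testing text, for $c=1,\dots,C$ let $M_c=\sum_{j=1}^m\mathbb{I}(f^j(g^j(\mathbf{x}_{test}))=c)$, and let $y=f(\mathbf{x}_{test};\mathcal{D}(\emptyset))$. Let $\mathbf{e}$ be a set of trigger words, let $T_{\mathbf{e}}$ be a word-level or structure-level backdoor attack using $\mathbf{e}$, with resulting backdoored training dataset $\mathcal{D}(T_{\mathbf{e}})$ and backdoored testing text $\mathbf{x}'_{test}$, and let $\Gamma\subseteq\{1,\dots,m\}$ be a set of $|\mathbf{e}|$ group indices containing the group index of every word of $\mathbf{e}$ (the potentially corrupted groups). If $$M_y-\sum_{j\in\Gamma}\mathbb{I}\bigl(f^j(g^j(\mathbf{x}_{test}))=y\bigr)\;\ge\;\max_{c\neq y}\Bigl(M_c+\sum_{j\in\Gamma}\mathbb{I}\bigl(f^j(g^j(\mathbf{x}_{test}))\neq c\bigr)+\mathbb{I}(y>c)\Bigr),$$ then the ensemble classifier built upon $\mathcal{D}(T_{\mathbf{e}})$ still predicts $y$, that is, $f(\mathbf{x}'_{test};\mathcal{D}(T_{\mathbf{e}}))=y$.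
   Context: Texts and datasets. A text is a finite sequence of words $\mathbf{x}=(x^1,\dots,x^d)$. A dataset is a finite list $\mathcal{D}=((\mathbf{x}_1,y_1),\dots,(\mathbf{x}_n,y_n))$ of (text, label) pairs with labels in $\{1,\dots,C\}$, $C\ge 2$. $\mathbb{I}$ is the indicator function. Grouping. Fix an integer $m\ge 1$ and a hash function $\mathcal{H}$ from words to integers. The group index of a word $w$ is $(\mathcal{H}(w)\bmod m)+1\in\{1,\dots,m\}$. For a text $\mathbf{x}$ and $j\in\{1,\dots,m\}$, $g^j(\mathbf{x})$ is the sequence of all word occurrences of $\mathbf{x}$ (with multiplicity) whose group index is $j$, sorted according to a fixed pre-defined ordering of words (each word has its own pre-defined ID), so that the order of words in $g^j(\mathbf{x})$ is independent of their order in $\mathbf{x}$. Ensemble classifier. From $\mathcal{D}$ form the sub-datasets $\mathcal{D}^j=((g^j(\mathbf{x}_1),y_1),\dots,(g^j(\mathbf{x}_n),y_n))$, $j=1,\dots,m$. A fixed training algorithm $\mathcal{A}$, arbitrary but deterministic (fixed seed: the same training dataset always gives the same classifier), maps a dataset to a classifier from texts to $\{1,\dots,C\}$. The base classifiers built upon $\mathcal{D}$ are $\mathcal{A}(\mathcal{D}^j)$, $j=1,\dots,m$. The ensemble classifier built upon $\mathcal{D}$ evaluates, on a testing text $\mathbf{x}$, the $j$-th base classifier on $g^j(\mathbf{x})$ for each $j$ and outputs as $f(\mathbf{x};\mathcal{D})$ the label receiving the largest number of votes, with ties broken in favour of the smallest label index. Attacks. A set $\mathbf{e}$ of trigger words is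 a finite set of words; its size $|\mathbf{e}|$ is the number of words in it. A word-level attack with trigger words $\mathbf{e}$ turns a text into a backdoored text by arbitrarily inserting words from $\mathbf{e}$ into it. A structure-level attack with trigger words $\mathbf{e}$ may arbitrarily change the order of the words of the text and arbitrarily insert words from $\mathbf{e}$ into it. $T_{\mathbf{e}}$ denotes the trigger injection operation of such an attack; $\mathbf{x}'_{test}=T_{\mathbf{e}}(\mathbf{x}_{test})$. Poisoned and certified datasets. $\mathcal{D}(T_{\mathbf{e}})$ is obtained from a clean training dataset by selecting a fraction $p$ of the training instances, replacing their texts by backdoored texts via $T_{\mathbf{e}}$, and relabeling them as a target class $y_{tc}$. In a mixed-label attack the selected instances may come from arbitrary classes; in a clean-label attack they all originally have label $y_{tc}$. The certified training dataset $\mathcal{D}(\emptyset)$ is the corresponding dataset without any trigger: the same instances are relabeled as $y_{tc}$, but no text is modified (so for clean-label attacks it equals the clean dataset). In particular $\mathcal{D}(\emptyset)$ and $\mathcal{D}(T_{\mathbf{e}})$ have the same labels, instance by instance, and differ only in the texts of the selected instances. *)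

theory Defs
  imports Complex_Main "HOL-Library.Multiset"
begin

type_synonym 'w word_seq = "'w list"
type_synonym 'w dataset = "('w word_seq \<times> nat) list"

text \<open>Classifiers take values in \<^term>\<open>{1..C}\<close> only by hypothesis; see \<open>training_algorithm\<close>.\<close>

type_synonym 'w classifier = "'w word_seq \<Rightarrow> nat"

definition labels_in :: "nat \<Rightarrow> 'w dataset \<Rightarrow> bool" where
  "labels_in C D \<longleftrightarrow> (\<forall>(x, y) \<in> set D. y \<in> {1..C})"

definition training_algorithm :: "nat \<Rightarrow> ('w dataset \<Rightarrow> 'w classifier) \<Rightarrow> bool" where
  "training_algorithm C A \<longleftrightarrow> (\<forall>D. labels_in C D \<longrightarrow> (\<forall>x. A D x \<in> {1..C}))"

definition group_index :: "nat \<Rightarrow> ('w \<Rightarrow> int) \<Rightarrow> 'w \<Rightarrow> nat" where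
  "group_index m H w = nat (H w mod int m) + 1"

text \<open>\<open>wid\<close> gives the pre-defined word IDs. It is assumed injective where it is used; otherwise
  \<^const>\<open>sort_key\<close>, being stable, would let the order within the text break ties.\<close>

definition group_text :: "nat \<Rightarrow> ('w \<Rightarrow> int) \<Rightarrow> ('w \<Rightarrow> 'k::linorder) \<Rightarrow> nat \<Rightarrow> 'w word_seq \<Rightarrow> 'w word_seq" where
  "group_text m H wid j x = sort_key wid (filter (\<lambda>w. group_index m H w = j) x)"

definition sub_dataset :: "nat \<Rightarrow> ('w \<Rightarrow> int) \<Rightarrow> ('w \<Rightarrow> 'k::linorder) \<Rightarrow> nat \<Rightarrow> 'w dataset \<Rightarrow> 'w dataset" where
  "sub_dataset m H wid j D = map (\<lambda>(x, y). (group_text m H wid j x, y)) D"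

definition base_classifier ::
  "nat \<Rightarrow> ('w \<Rightarrow> int) \<Rightarrow> ('w \<Rightarrow> 'k::linorder) \<Rightarrow> ('w dataset \<Rightarrow> 'w classifier) \<Rightarrow> 'w dataset \<Rightarrow> nat \<Rightarrow> 'w classifier" where
  "base_classifier m H wid A D j = A (sub_dataset m H wid j D)"

definition votes ::
  "nat \<Rightarrow> ('w \<Rightarrow> int) \<Rightarrow> ('w \<Rightarrow> 'k::linorder) \<Rightarrow> ('w dataset \<Rightarrow> 'w classifier) \<Rightarrow> 'w dataset \<Rightarrow> 'w word_seq \<Rightarrow> nat \<Rightarrow> nat" where
  "votes m H wid A D x c =
     (\<Sum>j = 1..m. of_bool (base_classifier m H wid A D j (group_text m H wid j x) = c))"

definition ensemble ::
  "nat \<Rightarrow> nat \<Rightarrow> ('w \<Rightarrow> int) \<Rightarrow> ('w \<Rightarrow> 'k::linorder) \<Rightarrow> ('w dataset \<Rightarrow> 'w classifier) \<Rightarrow> 'w dataset \<Rightarrow> 'w classifier" where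
  "ensemble C m H wid A D x =
     (LEAST c. c \<in> {1..C} \<and>
        (\<forall>c' \<in> {1..C}. votes m H wid A D x c' \<le> votes m H wid A D x c))"

text \<open>A trigger injection operation is a relation between texts and their backdoored versions,
  so that the place and number of the inserted words (and the reordering) may differ from one
  use to the next; an operation given by a function \<open>t\<close> is the relation \<open>\<lambda>x x'. x' = t x\<close>.
  Inserting words of \<open>e\<close> into \<open>x\<close> means interleaving \<open>x\<close> with some list of words of \<open>e\<close>.\<close>

definition word_level_attack :: "'w set \<Rightarrow> ('w word_seq \<Rightarrow> 'w word_seq \<Rightarrow> bool) \<Rightarrow> bool" where
  "word_level_attack e T \<longleftrightarrow>
     (\<forall>x x'. T x x' \<longrightarrow> (\<exists>zs. set zs \<subseteq> e \<and> x' \<in> shuffles x zs))"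

definition structure_level_attack :: "'w set \<Rightarrow> ('w word_seq \<Rightarrow> 'w word_seq \<Rightarrow> bool) \<Rightarrow> bool" where
  "structure_level_attack e T \<longleftrightarrow>
     (\<forall>x x'. T x x' \<longrightarrow>
        (\<exists>u zs. mset u = mset x \<and> set zs \<subseteq> e \<and> x' \<in> shuffles u zs))"

text \<open>\<open>S\<close> is the set of (zero-based) positions of the selected training instances, a fraction
  \<open>p\<close> of all of them.\<close>

definition mixed_label_selection :: "real \<Rightarrow> 'w dataset \<Rightarrow> nat set \<Rightarrow> bool" where
  "mixed_label_selection p D S \<longleftrightarrow>
     S \<subseteq> {..<length D} \<and> real (card S) = p * real (length D)"

definition clean_label_selection :: "real \<Rightarrow> nat \<Rightarrow> 'w dataset \<Rightarrow> nat set \<Rightarrow> bool" where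
  "clean_label_selection p ytc D S \<longleftrightarrow>
     S \<subseteq> {..<length D} \<and> real (card S) = p * real (length D) \<and> (\<forall>i \<in> S. snd (D ! i) = ytc)"

definition certified_dataset :: "nat \<Rightarrow> nat set \<Rightarrow> 'w dataset \<Rightarrow> 'w dataset" where
  "certified_dataset ytc S D =
     map (\<lambda>i. (fst (D ! i), if i \<in> S then ytc else snd (D ! i))) [0..<length D]"

definition backdoored_dataset ::
  "('w word_seq \<Rightarrow> 'w word_seq \<Rightarrow> bool) \<Rightarrow> nat \<Rightarrow> nat set \<Rightarrow> 'w dataset \<Rightarrow> 'w dataset \<Rightarrow> bool" where
  "backdoored_dataset T ytc S D D' \<longleftrightarrow>
     length D' = length D \<and>
     (\<forall>i < length D.
        if i \<in> S then T (fst (D ! i)) (fst (D' ! i)) \<and> snd (D' ! i) = ytc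
        else D' ! i = D ! i)"

end

(* A word of e only reaches the groups in \<Gamma>, and the sorted group texts do not depend on the
   word order, so outside \<Gamma> the base classifiers and their inputs are unchanged. At worst every
   vote in \<Gamma> turns against y and in favour of its competitor, which the margin absorbs. *)

theory Submission
  imports Defs
begin

text \<open>Take \<open>u = x\<close>, that is, no reordering; only structure-level attacks then
  need to be treated.\<close>

lemma word_level_imp_structure_level:
  assumes "word_level_attack e T"
  shows "structure_level_attack e T"
  using assms unfolding word_level_attack_def structure_level_attack_def by metis

text \<open>With \<open>wid\<close> injective, distinct words never tie in the sort, so the sorted
  list depends only on the multiset of words.\<close>

lemma group_text_cong_mset:
  assumes "inj wid"
    and "mset (filter (\<lambda>w. group_index m H w = j) x) =
         mset (filter (\<lambda>w. group_index m H w = j) x')"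
  shows "group_text m H wid j x = group_text m H wid j x'"
  unfolding group_text_def
  using assms
  by (intro sort_key_inj_key_eq) (auto intro: inj_on_subset)

text \<open>Reordering preserves the multiset of words and interleaving adds that of
  \<open>zs\<close>, which the filter for group \<open>j\<close> removes entirely.\<close>

lemma group_text_attack:
  assumes "inj wid" and "structure_level_attack e T" and "T x x'"
    and "j \<notin> group_index m H ` e"
  shows "group_text m H wid j x' = group_text m H wid j x"
proof -
  obtain u zs where u: "mset u = mset x" and zs: "set zs \<subseteq> e" and sh: "x' \<in> shuffles u zs"
    using assms unfolding structure_level_attack_def by blast
  have "filter (\<lambda>w. group_index m H w = j) zs = []"
    using zs assms by (auto simp: filter_empty_conv)
  then have "filter_mset (\<lambda>w. group_index m H w = j) (mset zs) = {#}"
    by (simp flip: mset_filter)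
  moreover have "mset x' = mset x + mset zs"
    using mset_shuffles[OF sh] u by simp
  ultimately show ?thesis
    using assms by (intro group_text_cong_mset) simp_all
qed

lemma sub_dataset_backdoored:
  assumes "inj wid" and "structure_level_attack e T"
    and D': "backdoored_dataset T ytc S D D'"
    and "j \<notin> group_index m H ` e"
  shows "sub_dataset m H wid j D' = sub_dataset m H wid j (certified_dataset ytc S D)"
proof (rule nth_equalityI)
  show "length (sub_dataset m H wid j D') =
      length (sub_dataset m H wid j (certified_dataset ytc S D))"
    using D' by (simp add: backdoored_dataset_def sub_dataset_def certified_dataset_def)
next
  fix i assume "i < length (sub_dataset m H wid j D')"
  then have i: "i < length D" "i < length D'"
    using D' by (simp_all add: backdoored_dataset_def sub_dataset_def)
  have *: "if i \<in> S then T (fst (D ! i)) (fst (D' ! i)) \<and> snd (D' ! i) = ytc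
      else D' ! i = D ! i"
    using D' i unfolding backdoored_dataset_def by blast
  show "sub_dataset m H wid j D' ! i =
      sub_dataset m H wid j (certified_dataset ytc S D) ! i"
    \<comment> \<open>The open premise is \<open>T x x'\<close>, which \<open>*\<close> supplies
      exactly for the selected instances; labels agree in both cases.\<close>
    using * i group_text_attack[OF assms(1,2) _ assms(4)]
    by (simp add: sub_dataset_def certified_dataset_def case_prod_beta split: if_splits)
qed

text \<open>Finitely many vote counts attain their maximum, so \<open>LEAST\<close> ranges over a
  nonempty set and is a genuine label.\<close>

lemma ensemble_in_range:
  assumes "C \<ge> 1"
  shows "ensemble C m H wid A D x \<in> {1..C}"
proof -
  let ?v = "votes m H wid A D x"
  have "Max (?v ` {1..C}) \<in> ?v ` {1..C}"
    using assms by (intro Max_in) auto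
  then obtain c where "c \<in> {1..C}" "?v c = Max (?v ` {1..C})"
    by (metis imageE)
  then have "c \<in> {1..C} \<and> (\<forall>c' \<in> {1..C}. ?v c' \<le> ?v c)"
    by simp
  then show ?thesis
    unfolding ensemble_def by (rule LeastI2) blast
qed

text \<open>The term \<open>of_bool (y > c)\<close> encodes the tie-breaking: \<open>y\<close> must
  strictly beat smaller labels but may tie with larger ones.\<close>

lemma ensemble_eqI:
  assumes "y \<in> {1..C}"
    and "\<And>c. c \<in> {1..C} \<Longrightarrow> c \<noteq> y \<Longrightarrow>
      votes m H wid A D x c + of_bool (y > c) \<le> votes m H wid A D x y"
  shows "ensemble C m H wid A D x = y"
  unfolding ensemble_def
proof (rule Least_equality)
  show "y \<in> {1..C} \<and> (\<forall>c \<in> {1..C}. votes m H wid A D x c \<le> votes m H wid A D x y)"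
    using assms by (metis add_leD1 order_refl)
next
  fix c
  assume c: "c \<in> {1..C} \<and> (\<forall>c' \<in> {1..C}. votes m H wid A D x c' \<le> votes m H wid A D x c)"
  then have "votes m H wid A D x y \<le> votes m H wid A D x c"
    using assms(1) by blast
  then show "y \<le> c"
    using assms(2)[of c] c by (cases "y \<le> c") auto
qed

text \<open>Nothing is known about \<open>b\<close> on \<open>\<Gamma>\<close>: at worst every vote
  for \<open>c\<close> there is lost, or every other vote there turns to \<open>c\<close>. Working
  in \<open>int\<close> avoids truncated subtraction.\<close>

lemma count_change_bounds:
  fixes a b :: "'i \<Rightarrow> 'c"
  assumes "finite J" and "\<Gamma> \<subseteq> J" and "\<And>j. j \<in> J - \<Gamma> \<Longrightarrow> b j = a j"
  shows "(\<Sum>j\<in>J. of_bool (a j = c)) - (\<Sum>j\<in>\<Gamma>. of_bool (a j = c))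
           \<le> (\<Sum>j\<in>J. of_bool (b j = c) :: int)" (is ?lower)
    and "(\<Sum>j\<in>J. of_bool (b j = c) :: int)
           \<le> (\<Sum>j\<in>J. of_bool (a j = c)) + (\<Sum>j\<in>\<Gamma>. of_bool (a j \<noteq> c))" (is ?upper)
proof -
  have split: "sum h J = sum h (J - \<Gamma>) + sum h \<Gamma>" for h :: "'i \<Rightarrow> int"
    using assms by (simp add: sum.subset_diff)
  have outside: "(\<Sum>j\<in>J - \<Gamma>. of_bool (b j = c) :: int) = (\<Sum>j\<in>J - \<Gamma>. of_bool (a j = c))"
    using assms(3) by (intro sum.cong) auto
  have "0 \<le> (\<Sum>j\<in>\<Gamma>. of_bool (b j = c) :: int)"
    by (intro sum_nonneg) simp
  then show ?lower
    unfolding split outside by simp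
  \<comment> \<open>Each summand on the right equals 1, the most that a single group can
    contribute.\<close>
  have "(\<Sum>j\<in>\<Gamma>. of_bool (b j = c) :: int)
      \<le> (\<Sum>j\<in>\<Gamma>. of_bool (a j = c) + of_bool (a j \<noteq> c))"
    by (intro sum_mono) auto
  then show ?upper
    unfolding split outside by (simp add: sum.distrib)
qed

theorem mainTheorem2:
  fixes C m :: nat
    and H :: "'w \<Rightarrow> int"
    and wid :: "'w \<Rightarrow> 'k::linorder"
    and A :: "'w dataset \<Rightarrow> 'w classifier"
    and D D0 D' :: "'w dataset"
    and p :: real
    and S :: "nat set"
    and ytc y :: nat
    and e :: "'w set"
    and T :: "'w word_seq \<Rightarrow> 'w word_seq \<Rightarrow> bool"
    and x x' :: "'w word_seq"
    and \<Gamma> :: "nat set"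
    and f :: "nat \<Rightarrow> 'w classifier"
    and g :: "nat \<Rightarrow> 'w word_seq \<Rightarrow> 'w word_seq"
    and M :: "nat \<Rightarrow> int"
  assumes "C \<ge> 2" and "m \<ge> 1"
    and "inj wid"
    and "training_algorithm C A"
    and "labels_in C D"
    and "ytc \<in> {1..C}"
    and "0 \<le> p" and "p \<le> 1"
    and "mixed_label_selection p D S \<or> clean_label_selection p ytc D S"
    and "finite e"
    and "word_level_attack e T \<or> structure_level_attack e T"
    and D0: "D0 = certified_dataset ytc S D"
    and D': "backdoored_dataset T ytc S D D'"
    and x': "T x x'"
    and g: "g = group_text m H wid"
    and f: "f = base_classifier m H wid A D0"
    and M: "\<And>c. M c = (\<Sum>j = 1..m. of_bool (f j (g j x) = c))"
    and y: "y = ensemble C m H wid A D0 x"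
    and "\<Gamma> \<subseteq> {1..m}" and "card \<Gamma> = card e" and "group_index m H ` e \<subseteq> \<Gamma>"
    and "M y - (\<Sum>j\<in>\<Gamma>. of_bool (f j (g j x) = y))
         \<ge> (MAX c \<in> {1..C} - {y}.
              M c + (\<Sum>j\<in>\<Gamma>. of_bool (f j (g j x) \<noteq> c)) + of_bool (y > c))"
  shows "ensemble C m H wid A D' x' = y"
proof (rule ensemble_eqI)
  show "y \<in> {1..C}"
    unfolding y using \<open>C \<ge> 2\<close> by (intro ensemble_in_range) simp
next
  fix c assume c: "c \<in> {1..C}" "c \<noteq> y"
  have attack: "structure_level_attack e T"
    using assms word_level_imp_structure_level by blast
  define b where "b j = base_classifier m H wid A D' j (group_text m H wid j x')" for j
  have b: "b j = f j (g j x)" if "j \<in> {1..m} - \<Gamma>" for j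
  proof -
    have j: "j \<notin> group_index m H ` e"
      using that \<open>group_index m H ` e \<subseteq> \<Gamma>\<close> by blast
    show ?thesis
      \<comment> \<open>Since \<open>A\<close> is a function, equal sub-datasets give the same base
        classifier, here applied to equal group texts.\<close>
      using group_text_attack[OF \<open>inj wid\<close> attack x' j]
        sub_dataset_backdoored[OF \<open>inj wid\<close> attack D' j]
      by (simp add: b_def f g D0 base_classifier_def)
  qed
  have votes: "int (votes m H wid A D' x' k) = (\<Sum>j = 1..m. of_bool (b j = k))" for k
    by (simp add: votes_def b_def)
  \<comment> \<open>The label stays schematic: the lower bound is used for \<open>y\<close>, the
    upper bound for its rival \<open>c\<close>.\<close>
  note bounds = count_change_bounds[of "{1..m}" \<Gamma> b "\<lambda>j. f j (g j x)",
      OF finite_atLeastAtMost \<open>\<Gamma> \<subseteq> {1..m}\<close> b, folded votes M]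
  let ?N = "\<lambda>c. M c + (\<Sum>j\<in>\<Gamma>. of_bool (f j (g j x) \<noteq> c)) + of_bool (y > c)"
  have "?N c \<le> (MAX c \<in> {1..C} - {y}. ?N c)"
    using c by (intro Max_ge) auto
  also have "\<dots> \<le> M y - (\<Sum>j\<in>\<Gamma>. of_bool (f j (g j x) = y))"
    using assms by blast
  also have "\<dots> \<le> int (votes m H wid A D' x' y)"
    by (rule bounds(1))
  finally have "int (votes m H wid A D' x' c) + of_bool (y > c) \<le> int (votes m H wid A D' x' y)"
    using bounds(2)[of c] by linarith
  then show "votes m H wid A D' x' c + of_bool (y > c) \<le> votes m H wid A D' x' y"
    by (cases "y > c") simp_all
qed

end
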